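(* Let $f:\mathbb{R}^N\to\mathbb{R}^N$ be smooth, and consider a weakly stable and consistent linear multistep method with coefficients $\alpha_m,\beta_m$, $0\le m\le M$. There exist unique $h$-independent functions $f_k$, $0\le k\le K$, such that $f_h^K=\sum_{k=0}^K h^kf_k$ satisfies $$\sum_{m=0}^M\alpha_m\phi_{mh,f}(x)=h\sum_{m=0}^M\beta_mf_h^K(\phi_{mh,f}(x))+O(h^{K+2})$$ for arbitrary initial value $x$. In particular, for $k\ge0$, the functions $f_k$ are given as $$f_k(y)=\frac{1}{\sum_{m=0}^M\beta_m}\sum_{m=0}^M\alpha_m\frac{m^{k+1}}{(k+1)!}(D^kf)(y)-\frac{1}{\sum_{m=0}^M\beta_m}\sum_{m=0}^M\beta_m\sum_{j=1}^k\frac{m^j}{j!}(D^jf_{k-j})(y).$$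
   Context: A linear multistep method for $\frac{d}{dt}y=f(y)$ with step $h$ is given by the formula $\sum_{m=0}^M\alpha_my_m-h\sum_{m=0}^M\beta_mf(y_m)=0$, where $\alpha_m,\beta_m$ are real parameters, $\alpha_M\ne0$ and $|\alpha_0|+|\beta_0|>0$. It is weakly stable if $\sum_{m=0}^M m\,\alpha_m\ne0$. It is consistent if $\sum_{m=0}^M\alpha_m=0$ and $\sum_{m=0}^M m\,\alpha_m=\sum_{m=0}^M\beta_m$; hence $\sum_{m=0}^M\beta_m\ne0$ under both conditions. $\phi_{t,f}(x)$ is the exact solution at time $t$ of $\frac{d}{dt}y=f(y)$, $y(0)=x$. $D$ is the Lie derivative along $f$: $(Dg)(y)=g'(y)f(y)$, where $g'$ is the Jacobian of $g$; $D^j$ is its $j$-th iterate, $D^0g=g$.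
   Formalization: Uniqueness of the f_k is asserted among continuous functions (the f_k themselves being smooth); among arbitrary functions it fails, e.g. for implicit Euler with f=1, K=0, where f_0 may be changed at one point. *)

theory Defs
  imports "HOL-Analysis.Analysis" "HOL-Library.Landau_Symbols"
begin

text \<open>A function is of class $C^k$ if all its iterated directional derivatives up to order $k$
  exist and are continuous. In finite dimension this is the usual notion. Each directional
  derivative has the type of the original function, which allows recursion on $k$.\<close>

primrec Ck_differentiable ::
  "nat \<Rightarrow> ('a::euclidean_space \<Rightarrow> 'b::real_normed_vector) \<Rightarrow> bool" where
  "Ck_differentiable 0 f \<longleftrightarrow> continuous_on UNIV f"
| "Ck_differentiable (Suc k) f \<longleftrightarrow>
     (\<forall>x. f differentiable (at x)) \<and>
     (\<forall>v. Ck_differentiable k (\<lambda>x. frechet_derivative f (at x) v))"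

definition smooth :: "('a::euclidean_space \<Rightarrow> 'b::real_normed_vector) \<Rightarrow> bool" where
  "smooth f \<longleftrightarrow> (\<forall>k. Ck_differentiable k f)"

definition solves_ivp ::
  "('a::real_normed_vector \<Rightarrow> 'a) \<Rightarrow> 'a \<Rightarrow> real set \<Rightarrow> (real \<Rightarrow> 'a) \<Rightarrow> bool" where
  "solves_ivp f x T y \<longleftrightarrow>
     y 0 = x \<and> (\<forall>s\<in>T. (y has_vector_derivative f (y s)) (at s within T))"

text \<open>The vector field is not assumed to be complete: the value below is only meaningful if the
  solution through \<open>x\<close> exists on the whole interval between \<open>0\<close> and \<open>t\<close>. For smooth \<open>f\<close> and fixed
  \<open>x\<close> this holds for all sufficiently small \<open>\<bar>t\<bar>\<close>, and the solution is unique there. The time \<open>t\<close>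
  may be negative.\<close>

definition flow :: "('a::real_normed_vector \<Rightarrow> 'a) \<Rightarrow> real \<Rightarrow> 'a \<Rightarrow> 'a" where
  "flow f t x = (THE z. \<exists>y. solves_ivp f x (closed_segment 0 t) y \<and> y t = z)"

definition lie_derivative ::
  "(real ^ 'n \<Rightarrow> real ^ 'n) \<Rightarrow> (real ^ 'n \<Rightarrow> real ^ 'n) \<Rightarrow> (real ^ 'n \<Rightarrow> real ^ 'n)" where
  "lie_derivative f g = (\<lambda>y. jacobian g (at y) *v f y)"

text \<open>A linear multistep method is represented by its coefficient sequences \<open>\<alpha>\<close>, \<open>\<beta>\<close> and the
  number of steps \<open>M\<close>; values of the sequences beyond index \<open>M\<close> are irrelevant.\<close>

definition linear_multistep_method :: "nat \<Rightarrow> (nat \<Rightarrow> real) \<Rightarrow> (nat \<Rightarrow> real) \<Rightarrow> bool" where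
  "linear_multistep_method M \<alpha> \<beta> \<longleftrightarrow> \<alpha> M \<noteq> 0 \<and> \<bar>\<alpha> 0\<bar> + \<bar>\<beta> 0\<bar> > 0"

definition weakly_stable :: "nat \<Rightarrow> (nat \<Rightarrow> real) \<Rightarrow> bool" where
  "weakly_stable M \<alpha> \<longleftrightarrow> (\<Sum>m\<le>M. real m * \<alpha> m) \<noteq> 0"

definition consistent :: "nat \<Rightarrow> (nat \<Rightarrow> real) \<Rightarrow> (nat \<Rightarrow> real) \<Rightarrow> bool" where
  "consistent M \<alpha> \<beta> \<longleftrightarrow>
     (\<Sum>m\<le>M. \<alpha> m) = 0 \<and> (\<Sum>m\<le>M. real m * \<alpha> m) = (\<Sum>m\<le>M. \<beta> m)"

definition truncated_field ::
  "(nat \<Rightarrow> 'a \<Rightarrow> 'a) \<Rightarrow> nat \<Rightarrow> real \<Rightarrow> 'a \<Rightarrow> 'a::real_vector" where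
  "truncated_field F K h y = (\<Sum>k\<le>K. h ^ k *\<^sub>R F k y)"

text \<open>The initial value \<open>x\<close> is fixed before the limit \<open>h \<rightarrow> 0\<close>, so the constant in the error term
  may depend on \<open>x\<close>.\<close>

definition satisfies_multistep_to_order ::
  "nat \<Rightarrow> (nat \<Rightarrow> real) \<Rightarrow> (nat \<Rightarrow> real) \<Rightarrow> ('a::real_normed_vector \<Rightarrow> 'a)
    \<Rightarrow> nat \<Rightarrow> (nat \<Rightarrow> 'a \<Rightarrow> 'a) \<Rightarrow> bool" where
  "satisfies_multistep_to_order M \<alpha> \<beta> f K F \<longleftrightarrow>
     (\<forall>x. (\<lambda>h. norm ((\<Sum>m\<le>M. \<alpha> m *\<^sub>R flow f (real m * h) x)
              - h *\<^sub>R (\<Sum>m\<le>M. \<beta> m *\<^sub>R truncated_field F K h (flow f (real m * h) x))))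
          \<in> O[at 0](\<lambda>h. h ^ (K + 2)))"

end

theory Submission
  imports Defs
begin

text \<open>
  Along a solution \<open>y\<close> of \<open>y' = f(y)\<close> the time derivative of \<open>g(y(t))\<close> is \<open>(D g)(y(t))\<close>, so
  integrating an error bound \<open>O(t^n)\<close> for \<open>D g\<close> gives, by induction on \<open>n\<close>, the Taylor expansion of
  \<open>g(y(t))\<close> with coefficients \<open>(D^j g)(x) / j!\<close>. Applied to the identity and to each \<open>f_k\<close>, it turns
  the defect of the multistep relation into a polynomial in \<open>h\<close> up to \<open>O(h^(K+2))\<close>: the constant
  term vanishes by consistency, and the coefficient of \<open>h^(k+1)\<close> vanishes iff the recursion for \<open>f_k\<close>
  holds, which is solvable because \<open>\<Sum>m\<le>M. \<beta> m \<noteq> 0\<close>. For uniqueness, the difference of two solutions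
  that agree below index \<open>k\<close> is \<open>h^(k+1)\<close> times a quantity which tends to
  \<open>(\<Sum>m\<le>M. \<beta> m) (g_k - f_k)(x)\<close> and is \<open>O(h)\<close>. The solution near time \<open>0\<close> comes from
  Picard iteration.
\<close>

section \<open>Smooth functions and Lie derivatives\<close>

lemma Ck_differentiable_continuous_on:
  assumes "Ck_differentiable k f"
  shows "continuous_on UNIV f"
proof (cases k)
  case 0
  with assms show ?thesis by simp
next
  case (Suc n)
  with assms have "f differentiable_on UNIV" by (auto simp: differentiable_on_def)
  then show ?thesis by (rule differentiable_imp_continuous_on)
qed

lemma Ck_differentiable_Suc_imp:
  "Ck_differentiable (Suc k) f \<Longrightarrow> Ck_differentiable k f"
proof (induction k arbitrary: f)
  case 0
  then show ?case using Ck_differentiable_continuous_on[OF 0] by simp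
next
  case (Suc k)
  then show ?case by (metis Ck_differentiable.simps(2))
qed

lemma Ck_differentiable_add:
  "Ck_differentiable k f \<Longrightarrow> Ck_differentiable k g \<Longrightarrow> Ck_differentiable k (\<lambda>x. f x + g x)"
proof (induction k arbitrary: f g)
  case 0
  then show ?case by (auto intro: continuous_on_add)
next
  case (Suc k)
  have "frechet_derivative (\<lambda>x. f x + g x) (at x) =
      (\<lambda>v. frechet_derivative f (at x) v + frechet_derivative g (at x) v)" for x
    using Suc.prems by (intro frechet_derivative_at[symmetric] has_derivative_add)
      (auto simp: frechet_derivative_works[symmetric])
  then show ?case using Suc by auto
qed

lemma Ck_differentiable_bounded_linear:
  assumes "bounded_linear L"
  shows "Ck_differentiable k f \<Longrightarrow> Ck_differentiable k (\<lambda>x. L (f x))"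
proof (induction k arbitrary: f)
  case 0
  then show ?case using bounded_linear.continuous_on[OF assms] by auto
next
  case (Suc k)
  have D: "((\<lambda>x. L (f x)) has_derivative (\<lambda>v. L (frechet_derivative f (at x) v))) (at x)" for x
    using Suc.prems by (intro bounded_linear.has_derivative[OF assms])
      (auto simp: frechet_derivative_works[symmetric])
  have "frechet_derivative (\<lambda>x. L (f x)) (at x) =
      (\<lambda>v. L (frechet_derivative f (at x) v))" "(\<lambda>x. L (f x)) differentiable (at x)" for x
    using frechet_derivative_at[OF D, symmetric] differentiableI[OF D] by auto
  then show ?case using Suc by auto
qed

lemma Ck_differentiable_scaleR:
  "Ck_differentiable k f \<Longrightarrow> Ck_differentiable k g \<Longrightarrow> Ck_differentiable k (\<lambda>x. f x *\<^sub>R g x)"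
proof (induction k arbitrary: f g)
  case 0
  then show ?case by (auto intro: continuous_on_scaleR)
next
  case (Suc k)
  have D: "((\<lambda>x. f x *\<^sub>R g x) has_derivative
      (\<lambda>v. f x *\<^sub>R frechet_derivative g (at x) v + frechet_derivative f (at x) v *\<^sub>R g x)) (at x)"
    for x
    using Suc.prems by (intro has_derivative_scaleR)
      (auto simp: frechet_derivative_works[symmetric])
  have *: "frechet_derivative (\<lambda>x. f x *\<^sub>R g x) (at x) =
      (\<lambda>v. f x *\<^sub>R frechet_derivative g (at x) v + frechet_derivative f (at x) v *\<^sub>R g x)"
    and **: "(\<lambda>x. f x *\<^sub>R g x) differentiable (at x)" for x
    using frechet_derivative_at[OF D, symmetric] differentiableI[OF D] by auto
  \<comment> \<open>The product rule leaves undifferentiated factors, so \<open>f\<close> and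
    \<open>g\<close> are first lowered from order \<open>Suc k\<close> to \<open>k\<close> before
    the induction hypothesis applies.\<close>
  have "Ck_differentiable k f" "Ck_differentiable k g"
    using Suc.prems Ck_differentiable_Suc_imp by auto
  with Suc ** show ?case by (auto simp: * intro!: Ck_differentiable_add)
qed

lemma Ck_differentiable_const: "Ck_differentiable k (\<lambda>x. c)"
  by (induction k arbitrary: c) auto

lemma smooth_const: "smooth (\<lambda>x. c)"
  by (simp add: smooth_def Ck_differentiable_const)

lemma smooth_ident: "smooth (\<lambda>x. x)"
proof -
  have "Ck_differentiable k (\<lambda>x::'a. x)" for k
    by (cases k) (auto simp: Ck_differentiable_const)
  then show ?thesis by (simp add: smooth_def)
qed

lemma smooth_add: "smooth f \<Longrightarrow> smooth g \<Longrightarrow> smooth (\<lambda>x. f x + g x)"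
  by (simp add: smooth_def Ck_differentiable_add)

lemma smooth_bounded_linear: "bounded_linear L \<Longrightarrow> smooth f \<Longrightarrow> smooth (\<lambda>x. L (f x))"
  by (simp add: smooth_def Ck_differentiable_bounded_linear)

lemma smooth_scaleR: "smooth f \<Longrightarrow> smooth g \<Longrightarrow> smooth (\<lambda>x. f x *\<^sub>R g x)"
  by (simp add: smooth_def Ck_differentiable_scaleR)

lemma smooth_diff: "smooth f \<Longrightarrow> smooth g \<Longrightarrow> smooth (\<lambda>x. f x - g x)"
  using smooth_add[OF _ smooth_bounded_linear[OF bounded_linear_minus[OF bounded_linear_ident]]]
  by fastforce

lemma smooth_sum: "(\<And>i. i \<in> I \<Longrightarrow> smooth (f i)) \<Longrightarrow> smooth (\<lambda>x. \<Sum>i\<in>I. f i x)"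
  by (induction I rule: infinite_finite_induct) (auto simp: smooth_const intro: smooth_add)

lemma smooth_continuous_on: "smooth f \<Longrightarrow> continuous_on S f"
  by (rule continuous_on_subset[of UNIV])
    (auto simp: smooth_def intro: Ck_differentiable_continuous_on)

lemma smooth_has_derivative:
  "smooth f \<Longrightarrow> (f has_derivative frechet_derivative f (at x)) (at x)"
  unfolding smooth_def frechet_derivative_works[symmetric] using Ck_differentiable.simps(2) by blast

lemma smooth_frechet_derivative: "smooth f \<Longrightarrow> smooth (\<lambda>x. frechet_derivative f (at x) v)"
  unfolding smooth_def using Ck_differentiable.simps(2) by blast

text \<open>Replaces the Jacobian matrix by the Frechet derivative, the form to which the chain rule
  and the smoothness lemmas apply.\<close>

lemma lie_derivative_eq:
  assumes "smooth g"
  shows "lie_derivative f g y = frechet_derivative g (at y) (f y)"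
proof -
  have "(g has_derivative (\<lambda>v. jacobian g (at y) *v v)) (at y)"
    using smooth_has_derivative[OF assms] jacobian_works differentiableI by blast
  then show ?thesis
    unfolding lie_derivative_def by (simp flip: frechet_derivative_at)
qed

text \<open>Smoothness controls derivatives in a fixed direction only, whereas the direction
  \<open>f y\<close> varies with \<open>y\<close>. Expanding \<open>f y\<close> in the basis gives a
  finite sum of products of smooth functions.\<close>

lemma smooth_lie_derivative:
  assumes "smooth f" "smooth g"
  shows "smooth (lie_derivative f g)"
proof -
  have "lie_derivative f g y = (\<Sum>b\<in>Basis. (f y \<bullet> b) *\<^sub>R frechet_derivative g (at y) b)" for y
  proof -
    have lin: "linear (frechet_derivative g (at y))"
      using assms(2) has_derivative_linear smooth_has_derivative by blast
    have "lie_derivative f g y = frechet_derivative g (at y) (\<Sum>b\<in>Basis. (f y \<bullet> b) *\<^sub>R b)"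
      using assms by (simp add: lie_derivative_eq euclidean_representation)
    then show ?thesis
      by (simp add: linear_sum[OF lin] linear_scale[OF lin])
  qed
  moreover have "smooth (\<lambda>y. \<Sum>b\<in>Basis. (f y \<bullet> b) *\<^sub>R frechet_derivative g (at y) b)"
    using assms by (intro smooth_sum smooth_scaleR smooth_frechet_derivative
        smooth_bounded_linear[OF bounded_linear_inner_left])
  ultimately show ?thesis by presburger
qed

lemma smooth_lie_derivative_funpow:
  "smooth f \<Longrightarrow> smooth g \<Longrightarrow> smooth ((lie_derivative f ^^ k) g)"
  by (induction k) (auto intro: smooth_lie_derivative)

text \<open>Compactness bounds the finitely many partial derivatives and hence the operator norm of
  the derivative; convexity then permits the mean value inequality.\<close>

lemma smooth_lipschitz_on_compact_convex:
  fixes f :: "'a::euclidean_space \<Rightarrow> 'b::real_normed_vector"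
  assumes "smooth f" "compact S" "convex S"
  obtains L where "L-lipschitz_on S f"
proof -
  have "\<exists>B. \<forall>x\<in>S. norm (frechet_derivative f (at x) b) \<le> B" for b
    using compact_imp_bounded[OF compact_continuous_image[OF smooth_continuous_on
          [OF smooth_frechet_derivative[OF assms(1)]] assms(2)]]
    unfolding bounded_iff by blast
  then obtain B where B: "\<And>b x. x \<in> S \<Longrightarrow> norm (frechet_derivative f (at x) b) \<le> B b"
    by metis
  have "onorm (frechet_derivative f (at x)) \<le> (\<Sum>b\<in>Basis. B b)" if "x \<in> S" for x
  proof (rule onorm_bound)
    have lin: "linear (frechet_derivative f (at x))"
      using assms(1) has_derivative_linear smooth_has_derivative by blast
    show "0 \<le> (\<Sum>b\<in>Basis. B b)"
      using B[OF that] by (intro sum_nonneg) (meson norm_ge_zero order_trans)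
    fix v
    have "frechet_derivative f (at x) v = (\<Sum>b\<in>Basis. (v \<bullet> b) *\<^sub>R frechet_derivative f (at x) b)"
      by (subst euclidean_representation[of v, symmetric])
        (simp only: linear_sum[OF lin] linear_scale[OF lin])
    also have "norm \<dots> \<le> (\<Sum>b\<in>Basis. B b * norm v)"
      using B[OF that] by (intro sum_norm_le)
        (metis norm_scaleR Basis_le_norm mult.commute mult_mono norm_ge_zero abs_ge_zero)
    finally show "norm (frechet_derivative f (at x) v) \<le> (\<Sum>b\<in>Basis. B b) * norm v"
      by (simp add: sum_distrib_right)
  qed
  then have bd: "norm (f x - f y) \<le> (\<Sum>b\<in>Basis. B b) * norm (x - y)" if "x \<in> S" "y \<in> S" for x y
    using that by (intro differentiable_bound[OF assms(3)])
      (auto intro: has_derivative_at_withinI smooth_has_derivative assms)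
  \<comment> \<open>For empty \<open>S\<close> the bounds \<open>B\<close> are arbitrary and may
    have a negative sum, while a Lipschitz constant must be nonnegative.\<close>
  have "(max 0 (\<Sum>b\<in>Basis. B b))-lipschitz_on S f"
  proof (rule lipschitz_onI)
    fix x y assume "x \<in> S" "y \<in> S"
    then have "norm (f x - f y) \<le> (\<Sum>b\<in>Basis. B b) * norm (x - y)" by (rule bd)
    also have "\<dots> \<le> max 0 (\<Sum>b\<in>Basis. B b) * norm (x - y)"
      by (rule mult_right_mono) auto
    finally show "dist (f x) (f y) \<le> max 0 (\<Sum>b\<in>Basis. B b) * dist x y"
      by (simp add: dist_norm)
  qed simp
  then show ?thesis using that by blast
qed

section \<open>Local solutions of ordinary differential equations\<close>

text \<open>The derivative of the squared norm of \<open>w\<close> is at most \<open>2 * C\<close>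
  times that squared norm, so the weight \<open>exp (- (2 * C * s))\<close> makes the product
  nonincreasing; it starts at 0 and is nonnegative.\<close>

lemma gronwall_zero:
  fixes w :: "real \<Rightarrow> 'a::real_inner"
  assumes "w 0 = 0"
    and w': "\<And>s. s \<in> {0..1} \<Longrightarrow> (w has_vector_derivative w' s) (at s within {0..1})"
    and bd: "\<And>s. s \<in> {0..1} \<Longrightarrow> norm (w' s) \<le> C * norm (w s)"
  shows "w 1 = 0"
proof -
  let ?e = "\<lambda>s. exp (- (2 * C * s)) * (w s \<bullet> w s)"
  have "?e 1 \<le> ?e 0"
  proof (rule DERIV_nonpos_imp_decreasing_open[of 0 1 ?e])
    show "continuous_on {0..1} ?e"
      using has_vector_derivative_continuous[OF w']
      by (intro continuous_intros) (auto simp: continuous_on_eq_continuous_within)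
    fix s :: real assume s: "0 < s" "s < 1"
    have "at s within {0..1} = at s"
      using s by (intro at_within_interior) auto
    then have *: "(w has_derivative (\<lambda>h. h *\<^sub>R w' s)) (at s)"
      using w'[of s] s by (simp add: has_vector_derivative_def)
    have "((\<lambda>s. w s \<bullet> w s) has_real_derivative (2 * (w s \<bullet> w' s))) (at s)"
      unfolding has_field_derivative_def
      by (rule has_derivative_eq_rhs[OF has_derivative_inner[OF * *]])
        (auto simp: algebra_simps inner_commute)
    then have "(?e has_real_derivative
        exp (- (2 * C * s)) * (2 * (w s \<bullet> w' s) - 2 * C * (w s \<bullet> w s))) (at s)"
      by (auto intro!: derivative_eq_intros simp: algebra_simps)
    moreover have "w s \<bullet> w' s \<le> C * (w s \<bullet> w s)"
    proof -
      have "w s \<bullet> w' s \<le> norm (w s) * norm (w' s)"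
        by (rule norm_cauchy_schwarz)
      also have "\<dots> \<le> norm (w s) * (C * norm (w s))"
        using bd[of s] s by (intro mult_left_mono) auto
      finally show ?thesis by (simp add: dot_square_norm power2_eq_square algebra_simps)
    qed
    ultimately show "\<exists>y. (?e has_real_derivative y) (at s) \<and> y \<le> 0"
      by (intro exI conjI) (auto simp: mult_nonneg_nonpos)
  qed simp
  then have "exp (- (2 * C)) * (w 1 \<bullet> w 1) \<le> 0" using assms(1) by simp
  then have "w 1 \<bullet> w 1 \<le> 0" by (simp add: mult_le_0_iff)
  then show ?thesis using inner_ge_zero[of "w 1"] by (metis antisym inner_eq_zero_iff)
qed

text \<open>Both solutions are bounded on the compact segment, hence lie in a common ball on which
  \<open>f\<close> is Lipschitz. Their difference then satisfies the Gronwall hypothesis, whatever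
  the length of the segment.\<close>

lemma solves_ivp_unique:
  fixes f :: "'a::euclidean_space \<Rightarrow> 'a"
  assumes f: "smooth f"
    and y: "solves_ivp f x (closed_segment 0 t) y"
    and z: "solves_ivp f x (closed_segment 0 t) z"
  shows "y t = z t"
proof -
  \<comment> \<open>Rescaling time to \<open>{0..1}\<close> treats both signs of \<open>t\<close> at once.\<close>
  have rescale: "((\<lambda>s. u (s * t)) has_vector_derivative t *\<^sub>R f (u (s * t))) (at s within {0..1})"
    if u: "solves_ivp f x (closed_segment 0 t) u" and "s \<in> {0..1}" for u s
  proof -
    have im: "(\<lambda>s. s * t) ` {0..1} = closed_segment 0 t"
      by (auto simp: closed_segment_def)
    have "((\<lambda>s. s * t) has_vector_derivative t) (at s within {0..1})"
      by (auto intro!: derivative_eq_intros simp flip: has_real_derivative_iff_has_vector_derivative)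
    from vector_diff_chain_within[OF this, of u "f (u (s * t))"] show ?thesis
      using u that(2) unfolding im solves_ivp_def o_def by (metis im imageI)
  qed
  have cont: "continuous_on {0..1} (\<lambda>s. u (s * t))"
    if u: "solves_ivp f x (closed_segment 0 t) u" for u
    using has_vector_derivative_continuous[OF rescale[OF u]]
    by (auto simp: continuous_on_eq_continuous_within)
  have "bounded ((\<lambda>s. y (s * t)) ` {0..1} \<union> (\<lambda>s. z (s * t)) ` {0..1})"
    using cont[OF y] cont[OF z] by (simp add: compact_imp_bounded compact_continuous_image)
  then obtain R
    where R: "(\<lambda>s. y (s * t)) ` {0..1} \<union> (\<lambda>s. z (s * t)) ` {0..1} \<subseteq> cball 0 R"
    unfolding bounded_iff by (metis mem_cball_0 subsetI)
  obtain L where L: "L-lipschitz_on (cball 0 R) f"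
    using smooth_lipschitz_on_compact_convex[OF f compact_cball convex_cball] .
  have "y (1 * t) - z (1 * t) = 0"
  proof (rule gronwall_zero[where w = "\<lambda>s. y (s * t) - z (s * t)" and C = "\<bar>t\<bar> * L"
        and w' = "\<lambda>s. t *\<^sub>R f (y (s * t)) - t *\<^sub>R f (z (s * t))"])
    show "y (0 * t) - z (0 * t) = 0" using y z by (simp add: solves_ivp_def)
  next
    fix s :: real assume s: "s \<in> {0..1}"
    then have "y (s * t) \<in> cball 0 R" "z (s * t) \<in> cball 0 R"
      using R by (auto simp only: image_subset_iff Un_subset_iff)
    then have "norm (f (y (s * t)) - f (z (s * t))) \<le> L * norm (y (s * t) - z (s * t))"
      using lipschitz_onD[OF L] by (simp add: dist_norm)
    then show "norm (t *\<^sub>R f (y (s * t)) - t *\<^sub>R f (z (s * t)))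
        \<le> \<bar>t\<bar> * L * norm (y (s * t) - z (s * t))"
      by (simp add: mult.assoc mult_left_mono flip: scaleR_diff_right)
  qed (intro has_vector_derivative_diff rescale y z)
  then show ?thesis by simp
qed

section \<open>Existence of local solutions\<close>

lemma vector_differentiable_bound:
  fixes f :: "real \<Rightarrow> 'a::real_normed_vector"
  assumes "convex S" "\<And>t. t \<in> S \<Longrightarrow> (f has_vector_derivative f' t) (at t within S)"
    and B: "\<And>t. t \<in> S \<Longrightarrow> norm (f' t) \<le> B" and "s \<in> S" "t \<in> S"
  shows "norm (f s - f t) \<le> B * \<bar>s - t\<bar>"
proof -
  have "onorm (\<lambda>h. h *\<^sub>R f' t) \<le> B" if "t \<in> S" for t
    using B[OF that] order_trans[OF norm_ge_zero B[OF that]]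
    by (intro onorm_bound) (auto simp: mult.commute[of B] mult_left_mono)
  then show ?thesis
    using differentiable_bound[of S f "\<lambda>t h. h *\<^sub>R f' t" B s t] assms
    by (simp add: has_vector_derivative_def)
qed

text \<open>The Picard map contracts the complete space of bounded continuous functions with factor
  1/2; its fixed point solves the integral equation on \<open>{-r..r}\<close>.\<close>

lemma lipschitz_ode_local_solution:
  fixes g :: "'a::banach \<Rightarrow> 'a"
  assumes g: "L-lipschitz_on UNIV g"
  obtains r y where "r > 0" "y 0 = x"
    "\<And>t. t \<in> {-r..r} \<Longrightarrow> (y has_vector_derivative g (y t)) (at t within {-r..r})"
proof -
  have L: "L \<ge> 0" using g by (rule lipschitz_on_nonneg)
  \<comment> \<open>Chosen so that \<open>L * r \<le> 1 / 2\<close>; the summand 1 covers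
    \<open>L = 0\<close>.\<close>
  define r where "r = 1 / (2 * (L + 1))"
  have r: "r > 0" "L * r \<le> 1 / 2" using L by (auto simp: r_def field_simps)
  \<comment> \<open>Clamping time lets the Picard map act on bounded continuous functions on all of \<open>\<real>\<close>, and basing
    the integral at \<open>-r\<close> treats positive and negative times at once.\<close>
  define c where "c t = max (-r) (min r t)" for t
  have c: "c t \<in> {-r..r}" "t \<in> {-r..r} \<Longrightarrow> c t = t" for t
    using r by (auto simp: c_def)
  define I where "I y s = integral {-r..s} (\<lambda>t. g (apply_bcontfun y t))" for y s
  have I: "(I y has_vector_derivative g (apply_bcontfun y s)) (at s within {-r..r})"
    if "s \<in> {-r..r}" for y s
    unfolding I_def using that
    by (intro integral_has_vector_derivative
        continuous_on_compose2[OF lipschitz_on_continuous_on[OF g]]) auto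
  have contI: "continuous_on {-r..r} (I y)" for y
    using has_vector_derivative_continuous[OF I] by (auto simp: continuous_on_eq_continuous_within)
  \<comment> \<open>Subtracting \<open>I y 0\<close> turns the integral based at \<open>-r\<close>
    into the oriented integral from 0 to \<open>c t\<close>.\<close>
  define P where "P y = Bcontfun (\<lambda>t. x + I y (c t) - I y 0)" for y
  have "(\<lambda>t. x + I y (c t) - I y 0) \<in> bcontfun" for y
  proof -
    have cont: "continuous_on UNIV (\<lambda>t. I y (c t))"
      unfolding c_def
      by (rule continuous_on_compose2[OF contI]) (use r in \<open>auto intro!: continuous_intros\<close>)
    have "bounded (I y ` {-r..r})"
      by (intro compact_imp_bounded compact_continuous_image contI) auto
    then obtain B where "\<And>t. t \<in> {-r..r} \<Longrightarrow> norm (I y t) \<le> B"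
      unfolding bounded_iff by blast
    then have "norm (I y (c t)) \<le> B" for t
      using c(1) by blast
    then have "(\<lambda>t. I y (c t)) \<in> bcontfun" by (rule bcontfun_normI[OF cont])
    from minus_cont[OF plus_cont[OF const_bcontfun this] const_bcontfun] show ?thesis .
  qed
  then have P: "apply_bcontfun (P y) t = x + I y (c t) - I y 0" for y t
    by (simp add: P_def Bcontfun_inverse)
  have "dist (P y) (P z) \<le> 1 / 2 * dist y z" for y z
  proof (rule dist_bound)
    fix t
    \<comment> \<open>The mean value inequality for \<open>I y - I z\<close> between 0 and
      \<open>c t\<close> covers both signs of \<open>c t\<close>.\<close>
    have "norm ((I y (c t) - I z (c t)) - (I y 0 - I z 0)) \<le> (L * dist y z) * \<bar>c t - 0\<bar>"
    proof (rule vector_differentiable_bound)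
      show "((\<lambda>s. I y s - I z s) has_vector_derivative
        g (apply_bcontfun y s) - g (apply_bcontfun z s)) (at s within {-r..r})"
        if "s \<in> {-r..r}" for s
        using that by (intro has_vector_derivative_diff I)
      show "norm (g (apply_bcontfun y s) - g (apply_bcontfun z s)) \<le> L * dist y z" for s
        using lipschitz_onD[OF g, of "apply_bcontfun y s" "apply_bcontfun z s"]
          dist_bounded[of y s z] L
        by (simp add: dist_norm) (meson mult_left_mono order_trans)
    qed (use c r in auto)
    also have "\<dots> \<le> (L * dist y z) * r"
      using c(1)[of t] L by (intro mult_left_mono) auto
    also have "\<dots> \<le> 1 / 2 * dist y z"
      using mult_right_mono[OF r(2), of "dist y z"] by (simp add: algebra_simps)
    finally show "dist (apply_bcontfun (P y) t) (apply_bcontfun (P z) t) \<le> 1 / 2 * dist y z"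
      by (simp add: P dist_norm algebra_simps)
  qed
  then have "\<exists>!y. P y = y" by (intro banach_fix_type[of "1/2"]) auto
  then obtain y where y: "P y = y" by auto
  have eq: "apply_bcontfun y t = x + I y t - I y 0" if "t \<in> {-r..r}" for t
    using P[of y t] c(2)[OF that] by (simp add: y)
  show ?thesis
  proof
    show "r > 0" by fact
    show "apply_bcontfun y 0 = x" using eq[of 0] r by simp
    fix t assume t: "t \<in> {-r..r}"
    have "((\<lambda>t. x + I y t - I y 0) has_vector_derivative g (apply_bcontfun y t))
        (at t within {-r..r})"
      using I[OF t] by (auto intro!: derivative_eq_intros)
    then show "(apply_bcontfun y has_vector_derivative g (apply_bcontfun y t))
        (at t within {-r..r})"
      by (rule has_vector_derivative_transform[OF t, rotated]) (use eq in auto)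
  qed
qed

text \<open>Uniqueness makes the definite description in \<open>flow\<close> well defined, so any
  solution on the segment evaluates it.\<close>

lemma flow_eqI:
  fixes f :: "'a::euclidean_space \<Rightarrow> 'a"
  assumes "smooth f" "solves_ivp f x (closed_segment 0 t) y"
  shows "flow f t x = y t"
  unfolding flow_def using solves_ivp_unique[OF assms(1)] assms(2) by (intro the_equality) blast+

text \<open>The definition chooses a value for each \<open>t\<close> separately; differentiability
  in \<open>t\<close> follows once a single Picard solution is seen to give the values for all small
  \<open>t\<close>.\<close>

lemma flow_has_vector_derivative:
  fixes f :: "'a::euclidean_space \<Rightarrow> 'a"
  assumes f: "smooth f"
  obtains r where "r > 0" "flow f 0 x = x"
    "\<And>t. \<bar>t\<bar> < r \<Longrightarrow> ((\<lambda>t. flow f t x) has_vector_derivative f (flow f t x)) (at t)"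
proof -
  obtain L where L: "L-lipschitz_on (cball x 1) f"
    using smooth_lipschitz_on_compact_convex[OF f compact_cball convex_cball] .
  \<comment> \<open>Precomposition with the nearest-point retraction makes the field globally Lipschitz without
    changing it near \<open>x\<close>.\<close>
  let ?p = "closest_point (cball x 1)"
  have p: "?p z \<in> cball x 1" for z by (intro closest_point_in_set) auto
  have "L-lipschitz_on UNIV (\<lambda>z. f (?p z))"
  proof (rule lipschitz_onI)
    fix u v
    have "dist (f (?p u)) (f (?p v)) \<le> L * dist (?p u) (?p v)"
      by (intro lipschitz_onD[OF L] p)
    also have "\<dots> \<le> L * dist u v"
      by (intro mult_left_mono closest_point_lipschitz lipschitz_on_nonneg[OF L]) auto
    finally show "dist (f (?p u)) (f (?p v)) \<le> L * dist u v" .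
  qed (rule lipschitz_on_nonneg[OF L])
  from lipschitz_ode_local_solution[OF this, of x] obtain r y where r: "r > 0" and y0: "y 0 = x"
    and y: "\<And>t. t \<in> {-r..r} \<Longrightarrow> (y has_vector_derivative f (?p (y t))) (at t within {-r..r})"
    by metis
  have y': "(y has_vector_derivative f (?p (y t))) (at t)" if "\<bar>t\<bar> < r" for t
    using y[of t] at_within_interior[of t "{-r..r}"] that by (auto simp: abs_less_iff)
  \<comment> \<open>By continuity \<open>y\<close> stays in the unit ball around \<open>x\<close>
    for a short time; there the retraction is the identity and the modified field equals
    \<open>f\<close>.\<close>
  have "isCont y 0" using y'[of 0] r by (auto intro: has_vector_derivative_continuous)
  then obtain d where d: "d > 0" "\<And>t. \<bar>t\<bar> < d \<Longrightarrow> dist (y t) (y 0) < 1"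
    unfolding continuous_at_eps_delta by (metis diff_zero dist_norm real_norm_def zero_less_one)
  define e where "e = min r d"
  have y'': "(y has_vector_derivative f (y t)) (at t)" if "\<bar>t\<bar> < e" for t
  proof -
    have "y t \<in> cball x 1" using d(2)[of t] that y0 by (auto simp: e_def dist_commute)
    then show ?thesis
      using y'[of t] that closest_point_self[of "y t" "cball x 1"] by (simp add: e_def)
  qed
  have flow: "flow f t x = y t" if "\<bar>t\<bar> < e" for t
  proof (rule flow_eqI[OF f])
    have "\<bar>s\<bar> < e" if "s \<in> closed_segment 0 t" for s
      using that \<open>\<bar>t\<bar> < e\<close> by (auto simp: closed_segment_eq_real_ivl split: if_splits)
    then show "solves_ivp f x (closed_segment 0 t) y"
      using y'' y0 by (auto simp: solves_ivp_def intro: has_vector_derivative_at_within)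
  qed
  show ?thesis
  proof
    show "e > 0" using r d by (simp add: e_def)
    then show "flow f 0 x = x" using flow[of 0] y0 by simp
    fix t assume t: "\<bar>t\<bar> < e"
    show "((\<lambda>t. flow f t x) has_vector_derivative f (flow f t x)) (at t)"
      unfolding flow[OF t]
      by (rule has_vector_derivative_transform_within_open[OF y''[OF t], of "{-e<..<e}"])
        (use t flow in \<open>auto simp: abs_less_iff\<close>)
  qed
qed

section \<open>Taylor expansion along the flow\<close>

lemma flow_isCont:
  fixes f :: "'a::euclidean_space \<Rightarrow> 'a"
  assumes "smooth f"
  shows "isCont (\<lambda>t. flow f t x) 0" and "flow f 0 x = x"
proof -
  obtain r where r: "r > 0" "flow f 0 x = x"
    "\<And>t. \<bar>t\<bar> < r \<Longrightarrow> ((\<lambda>t. flow f t x) has_vector_derivative f (flow f t x)) (at t)"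
    using flow_has_vector_derivative[OF assms, of x] by blast
  from has_vector_derivative_continuous[OF r(3)[of 0]] r(1)
  show "isCont (\<lambda>t. flow f t x) 0" by simp
  show "flow f 0 x = x" by fact
qed

lemma flow_tendsto:
  fixes f :: "'a::euclidean_space \<Rightarrow> 'a"
  assumes "smooth f"
  shows "((\<lambda>h. flow f (c * h) x) \<longlongrightarrow> x) (at 0)"
proof -
  have "((\<lambda>h::real. c * h) \<longlongrightarrow> 0) (at 0)" by (auto intro!: tendsto_eq_intros)
  from isCont_tendsto_compose[OF flow_isCont(1)[OF assms] this] show ?thesis
    by (simp add: flow_isCont(2)[OF assms])
qed

text \<open>The induction ranges over all smooth \<open>g\<close>, because the step for
  \<open>g\<close> uses the bound for its Lie derivative. The base case is local boundedness by
  continuity.\<close>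

lemma flow_taylor:
  fixes f g :: "real ^ 'n \<Rightarrow> real ^ 'n"
  assumes f: "smooth f" and "smooth g"
  shows "\<exists>C. \<forall>\<^sub>F t in nhds 0. norm (g (flow f t x) -
    (\<Sum>j<n. (t ^ j / fact j) *\<^sub>R (lie_derivative f ^^ j) g x)) \<le> C * \<bar>t\<bar> ^ n"
  using assms(2)
proof (induction n arbitrary: g)
  case 0
  have "isCont (\<lambda>t. g (flow f t x)) 0"
    using isCont_o2[OF flow_isCont(1)[OF f], where g = g] smooth_continuous_on[OF 0, of UNIV]
    by (simp add: continuous_on_eq_continuous_at)
  then have "\<forall>\<^sub>F t in nhds 0. norm (g (flow f t x)) < norm (g (flow f 0 x)) + 1"
    by (intro order_tendstoD(2)[of _ "norm (g (flow f 0 x))"] tendsto_norm)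
      (auto simp: isCont_def tendsto_nhds_iff)
  then show ?case by (intro exI[of _ "norm (g (flow f 0 x)) + 1"]) (auto elim!: eventually_mono)
next
  case (Suc n)
  obtain r where r: "r > 0" "flow f 0 x = x"
    "\<And>t. \<bar>t\<bar> < r \<Longrightarrow> ((\<lambda>t. flow f t x) has_vector_derivative f (flow f t x)) (at t)"
    using flow_has_vector_derivative[OF f, of x] by blast
  let ?D = "lie_derivative f"
  let ?R = "\<lambda>n g t. g (flow f t x) - (\<Sum>j<n. (t ^ j / fact j) *\<^sub>R (?D ^^ j) g x)"
  obtain C d where d: "d > 0" and C: "\<And>t. \<bar>t\<bar> < d \<Longrightarrow> norm (?R n (?D g) t) \<le> C * \<bar>t\<bar> ^ n"
    using Suc.IH[OF smooth_lie_derivative[OF f Suc.prems]]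
    unfolding eventually_nhds_metric by (auto simp: dist_norm)
  \<comment> \<open>The time derivative of the remainder of order \<open>Suc n\<close> for
    \<open>g\<close> is the remainder of order \<open>n\<close> for its Lie derivative.\<close>
  have deriv: "(?R (Suc n) g has_vector_derivative ?R n (?D g) t) (at t)" if "\<bar>t\<bar> < r" for t
  proof -
    have g': "((\<lambda>t. g (flow f t x)) has_vector_derivative ?D g (flow f t x)) (at t)"
      using vector_derivative_diff_chain_within[OF r(3)[OF that]
          has_derivative_at_withinI[OF smooth_has_derivative[OF Suc.prems]]]
      by (simp add: o_def lie_derivative_eq[OF Suc.prems])
    have pow: "((\<lambda>t. (t ^ Suc j / fact (Suc j)) *\<^sub>R c) has_vector_derivative
        (t ^ j / fact j) *\<^sub>R c) (at t)" for j and c :: "real ^ 'n"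
    proof -
      have "((\<lambda>t. t ^ Suc j / fact (Suc j)) has_real_derivative (t ^ j / fact j)) (at t)"
        by (rule derivative_eq_intros refl | simp add: divide_simps del: of_nat_Suc)+
      from has_vector_derivative_scaleR[OF this has_vector_derivative_const[of c]] show ?thesis
        by simp
    qed
    have "((\<lambda>t. (t ^ 0 / fact 0) *\<^sub>R (?D ^^ 0) g x +
          (\<Sum>j<n. (t ^ Suc j / fact (Suc j)) *\<^sub>R (?D ^^ Suc j) g x))
        has_vector_derivative 0 + (\<Sum>j<n. (t ^ j / fact j) *\<^sub>R (?D ^^ Suc j) g x)) (at t)"
      by (intro has_vector_derivative_add has_vector_derivative_sum pow) simp
    then have "((\<lambda>t. \<Sum>j<Suc n. (t ^ j / fact j) *\<^sub>R (?D ^^ j) g x) has_vector_derivative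
        (\<Sum>j<n. (t ^ j / fact j) *\<^sub>R (?D ^^ j) (?D g) x)) (at t)"
      by (simp only: sum.lessThan_Suc_shift funpow_Suc_right o_apply add_0_left)
    then show ?thesis
      by (rule has_vector_derivative_diff[OF g'])
  qed
  have "norm (?R (Suc n) g t) \<le> \<bar>C\<bar> * \<bar>t\<bar> ^ Suc n" if t: "\<bar>t\<bar> < min r d" for t
  proof -
    have seg: "\<bar>s\<bar> \<le> \<bar>t\<bar>" if "s \<in> closed_segment 0 t" for s
      using that by (auto simp: closed_segment_eq_real_ivl split: if_splits)
    \<comment> \<open>The mean value inequality on the segment contributes the additional factor
      \<open>\<bar>t\<bar>\<close>. Passing to \<open>\<bar>C\<bar>\<close> makes the bound monotone
      in \<open>\<bar>s\<bar>\<close>.\<close>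
    have "norm (?R (Suc n) g t - ?R (Suc n) g 0) \<le> (\<bar>C\<bar> * \<bar>t\<bar> ^ n) * \<bar>t - 0\<bar>"
    proof (rule vector_differentiable_bound)
      fix s assume "s \<in> closed_segment 0 t"
      then have s: "\<bar>s\<bar> < r" "\<bar>s\<bar> < d" "\<bar>s\<bar> \<le> \<bar>t\<bar>" using seg[of s] t by auto
      show "(?R (Suc n) g has_vector_derivative ?R n (?D g) s) (at s within closed_segment 0 t)"
        using deriv[OF s(1)] by (rule has_vector_derivative_at_within)
      have "C * \<bar>s\<bar> ^ n \<le> \<bar>C\<bar> * \<bar>t\<bar> ^ n"
        using s(3) by (intro mult_mono power_mono) auto
      with C[OF s(2)] show "norm (?R n (?D g) s) \<le> \<bar>C\<bar> * \<bar>t\<bar> ^ n" by linarith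
    qed auto
    moreover have "?R (Suc n) g 0 = 0" by (simp add: sum.lessThan_Suc_shift r(2) del: sum.lessThan_Suc)
    ultimately show ?thesis by (simp add: mult_ac)
  qed
  then show ?case
    unfolding eventually_nhds_metric using r(1) d
    by (intro exI[of _ "\<bar>C\<bar>"] exI[of _ "min r d"]) (auto simp: dist_norm)
qed

text \<open>Matches the error term of \<open>satisfies_multistep_to_order\<close> but takes the
  vector-valued function as argument, so that errors can be added and rescaled as vectors.\<close>

definition vanishes_to_order :: "nat \<Rightarrow> (real \<Rightarrow> 'a::real_normed_vector) \<Rightarrow> bool" where
  "vanishes_to_order n u \<longleftrightarrow> (\<lambda>h. norm (u h)) \<in> O[at 0](\<lambda>h. h ^ n)"

section \<open>Arithmetic of vanishing orders\<close>

lemma vanishes_to_order_diff: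
  assumes "vanishes_to_order n u" "vanishes_to_order n v"
  shows "vanishes_to_order n (\<lambda>h. u h - v h)"
proof -
  have "(\<lambda>h. norm (u h - v h)) \<in> O[at 0](\<lambda>h. norm (u h) + norm (v h))"
    by (intro landau_o.big_mono always_eventually) (auto intro: norm_triangle_ineq4)
  also have "(\<lambda>h. norm (u h) + norm (v h)) \<in> O[at 0](\<lambda>h. h ^ n)"
    using assms unfolding vanishes_to_order_def by (rule sum_in_bigo)
  finally show ?thesis unfolding vanishes_to_order_def .
qed

lemma vanishes_to_order_sum:
  assumes "\<And>i. i \<in> I \<Longrightarrow> vanishes_to_order n (u i)"
  shows "vanishes_to_order n (\<lambda>h. \<Sum>i\<in>I. u i h)"
proof -
  have "(\<lambda>h. norm (\<Sum>i\<in>I. u i h)) \<in> O[at 0](\<lambda>h. \<Sum>i\<in>I. norm (u i h))"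
    by (intro landau_o.big_mono always_eventually allI) (auto intro: order_trans[OF norm_sum])
  also have "(\<lambda>h. \<Sum>i\<in>I. norm (u i h)) \<in> O[at 0](\<lambda>h. h ^ n)"
    using assms unfolding vanishes_to_order_def by (rule big_sum_in_bigo)
  finally show ?thesis unfolding vanishes_to_order_def .
qed

lemma vanishes_to_order_scaleR:
  "vanishes_to_order n u \<Longrightarrow> vanishes_to_order n (\<lambda>h. c *\<^sub>R u h)"
  unfolding vanishes_to_order_def by (cases "c = 0") auto

text \<open>The factor \<open>h ^ k\<close> cancels because \<open>h\<close> is nonzero in the
  punctured filter. One direction raises the order of Taylor errors; the other divides out the
  leading power in the uniqueness proof.\<close>

lemma vanishes_to_order_power_scaleR_iff:
  "vanishes_to_order (k + n) (\<lambda>h. h ^ k *\<^sub>R u h) \<longleftrightarrow> vanishes_to_order n u"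
proof -
  have "\<forall>\<^sub>F h in at (0::real). h ^ k \<noteq> 0"
    by (rule eventually_mono[OF eventually_neq_at_within[of 0]]) simp
  from landau_o.big.mult_cancel_left[OF bigtheta_refl this]
  have "(\<lambda>h. h ^ k * norm (u h)) \<in> O[at 0](\<lambda>h. h ^ k * h ^ n) \<longleftrightarrow>
    (\<lambda>h. norm (u h)) \<in> O[at 0](\<lambda>h. h ^ n)" by simp
  \<comment> \<open>Absolute values enter because \<open>h ^ k\<close> may be negative, while the
    norm of the scaled vector involves \<open>\<bar>h ^ k\<bar>\<close>.\<close>
  moreover have "(\<lambda>h. h ^ k * norm (u h)) \<in> O[at 0](\<lambda>h. h ^ k * h ^ n) \<longleftrightarrow>
    (\<lambda>h. \<bar>h ^ k * norm (u h)\<bar>) \<in> O[at 0](\<lambda>h. h ^ k * h ^ n)" by simp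
  ultimately show ?thesis
    by (simp add: vanishes_to_order_def power_add abs_mult)
qed

lemma vanishes_to_order_Suc_tendsto:
  assumes "vanishes_to_order (Suc n) u"
  shows "(u \<longlongrightarrow> 0) (at 0)"
proof -
  from assms obtain C where "\<forall>\<^sub>F h in at 0. norm (u h) \<le> C * \<bar>h\<bar> ^ Suc n"
    unfolding vanishes_to_order_def by (elim landau_o.bigE) (simp add: abs_mult power_abs)
  moreover have "((\<lambda>h::real. C * \<bar>h\<bar> ^ Suc n) \<longlongrightarrow> 0) (at 0)"
    by (auto intro!: tendsto_eq_intros)
  ultimately show ?thesis by (rule Lim_null_comparison)
qed

text \<open>Taylor expansion at time \<open>c * h\<close>, with the powers of \<open>h\<close>
  isolated for comparing coefficients.\<close>

lemma flow_taylor_vanishes_to_order: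
  fixes f g :: "real ^ 'n \<Rightarrow> real ^ 'n"
  assumes "smooth f" "smooth g"
  shows "vanishes_to_order n (\<lambda>h. g (flow f (c * h) x) -
    (\<Sum>j<n. h ^ j *\<^sub>R (c ^ j / fact j) *\<^sub>R (lie_derivative f ^^ j) g x))"
proof -
  obtain C where C: "\<forall>\<^sub>F t in nhds 0. norm (g (flow f t x) -
    (\<Sum>j<n. (t ^ j / fact j) *\<^sub>R (lie_derivative f ^^ j) g x)) \<le> C * \<bar>t\<bar> ^ n"
    using flow_taylor[OF assms] by blast
  \<comment> \<open>The target is the full neighbourhood filter, since \<open>c * h\<close> is
    constantly 0 when \<open>c = 0\<close>, as happens for the node \<open>m = 0\<close>.\<close>
  have "filterlim (\<lambda>h. c * h) (nhds 0) (at 0)" by (auto intro!: tendsto_eq_intros)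
  from eventually_compose_filterlim[OF C this]
  have "\<forall>\<^sub>F h in at 0. norm (g (flow f (c * h) x) -
    (\<Sum>j<n. h ^ j *\<^sub>R (c ^ j / fact j) *\<^sub>R (lie_derivative f ^^ j) g x))
      \<le> C * \<bar>c\<bar> ^ n * norm (h ^ n)"
    by (simp add: power_mult_distrib abs_mult power_abs mult_ac)
  then show ?thesis unfolding vanishes_to_order_def by (intro bigoI) simp
qed

section \<open>The modified vector field\<close>

text \<open>This is the equation for the coefficient of \<open>h ^ (k + 1)\<close> solved for its
  \<open>j = 0\<close> term, as a course-of-values recursion on \<open>k\<close>.\<close>

function modified_field ::
  "nat \<Rightarrow> (nat \<Rightarrow> real) \<Rightarrow> (nat \<Rightarrow> real) \<Rightarrow> (real ^ 'n \<Rightarrow> real ^ 'n) \<Rightarrow> nat \<Rightarrow> real ^ 'n \<Rightarrow> real ^ 'n"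
where
  "modified_field M \<alpha> \<beta> f k = (\<lambda>y.
     (1 / (\<Sum>m\<le>M. \<beta> m)) *\<^sub>R
       (\<Sum>m\<le>M. (\<alpha> m * (real m ^ (k + 1) / fact (k + 1))) *\<^sub>R (lie_derivative f ^^ k) f y)
   - (1 / (\<Sum>m\<le>M. \<beta> m)) *\<^sub>R
       (\<Sum>m\<le>M. \<beta> m *\<^sub>R
         (\<Sum>j=1..k. (real m ^ j / fact j) *\<^sub>R
           (lie_derivative f ^^ j) (modified_field M \<alpha> \<beta> f (k - j)) y)))"
  by pat_completeness auto
text \<open>The inner sum starts at \<open>j = 1\<close>, so each call has the smaller index
  \<open>k - j\<close>; for \<open>k = 0\<close> there is no call.\<close>

termination
  by (relation "Wellfounded.measure (\<lambda>(M, \<alpha>, \<beta>, f, k). k)") auto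

text \<open>The equation has no pattern on \<open>k\<close>, so as a rewrite rule it would keep
  unfolding its own right-hand side.\<close>

declare modified_field.simps [simp del]

lemma smooth_modified_field:
  assumes "smooth f"
  shows "smooth (modified_field M \<alpha> \<beta> f k)"
proof (induction k rule: less_induct)
  case (less k)
  show ?case
    unfolding modified_field.simps[of M \<alpha> \<beta> f k]
    by (intro smooth_diff smooth_bounded_linear[OF bounded_linear_scaleR_right] smooth_sum
        smooth_lie_derivative_funpow assms less.IH) auto
qed

text \<open>Undoes the solving step: the \<open>j = 0\<close> term contributes
  \<open>\<Sum>m\<le>M. \<beta> m\<close> times the \<open>k\<close>-th field, which cancels the
  reciprocal in the recursion.\<close>

lemma modified_field_coefficient_match:
  assumes "(\<Sum>m\<le>M. \<beta> m) \<noteq> 0"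
  shows "(\<Sum>m\<le>M. \<beta> m *\<^sub>R (\<Sum>j\<le>k. (real m ^ j / fact j) *\<^sub>R
      (lie_derivative f ^^ j) (modified_field M \<alpha> \<beta> f (k - j)) y)) =
    (\<Sum>m\<le>M. (\<alpha> m * (real m ^ (k + 1) / fact (k + 1))) *\<^sub>R (lie_derivative f ^^ k) f y)"
proof -
  let ?F = "modified_field M \<alpha> \<beta> f"
  have "{..k} = insert 0 {1..k}" by auto
  then have "(\<Sum>j\<le>k. (real m ^ j / fact j) *\<^sub>R (lie_derivative f ^^ j) (?F (k - j)) y) =
    ?F k y + (\<Sum>j=1..k. (real m ^ j / fact j) *\<^sub>R (lie_derivative f ^^ j) (?F (k - j)) y)" for m
    by simp
  then have "(\<Sum>m\<le>M. \<beta> m *\<^sub>R (\<Sum>j\<le>k. (real m ^ j / fact j) *\<^sub>R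
      (lie_derivative f ^^ j) (?F (k - j)) y)) =
    (\<Sum>m\<le>M. \<beta> m) *\<^sub>R ?F k y + (\<Sum>m\<le>M. \<beta> m *\<^sub>R (\<Sum>j=1..k. (real m ^ j / fact j) *\<^sub>R
      (lie_derivative f ^^ j) (?F (k - j)) y))"
    by (simp add: scaleR_add_right sum.distrib scaleR_sum_left)
  also have "\<dots> = (\<Sum>m\<le>M. (\<alpha> m * (real m ^ (k + 1) / fact (k + 1))) *\<^sub>R (lie_derivative f ^^ k) f y)"
    using assms by (subst (1) modified_field.simps) (simp add: scaleR_diff_right)
  finally show ?thesis .
qed

text \<open>Thus the Taylor coefficients of the flow itself involve iterated Lie derivatives of
  \<open>f\<close>, shifted by one index.\<close>

lemma lie_derivative_ident: "lie_derivative f (\<lambda>y. y) = f"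
  by (rule ext) (simp add: lie_derivative_eq smooth_ident)

text \<open>Replacing the flow and each \<open>F k\<close> along it by Taylor polynomials
  \<open>P\<close> and \<open>Q\<close> makes the polynomial parts cancel exactly; only truncation
  errors remain.\<close>

lemma multistep_residual_vanishes:
  fixes f :: "real ^ 'n \<Rightarrow> real ^ 'n"
  assumes f: "smooth f" and F: "\<And>k. smooth (F k)" and \<alpha>: "(\<Sum>m\<le>M. \<alpha> m) = 0"
    and match: "\<And>k y. (\<Sum>m\<le>M. \<beta> m *\<^sub>R (\<Sum>j\<le>k. (real m ^ j / fact j) *\<^sub>R
        (lie_derivative f ^^ j) (F (k - j)) y)) =
      (\<Sum>m\<le>M. (\<alpha> m * (real m ^ (k + 1) / fact (k + 1))) *\<^sub>R (lie_derivative f ^^ k) f y)"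
  shows "vanishes_to_order (K + 2) (\<lambda>h. (\<Sum>m\<le>M. \<alpha> m *\<^sub>R flow f (real m * h) x)
    - h *\<^sub>R (\<Sum>m\<le>M. \<beta> m *\<^sub>R truncated_field F K h (flow f (real m * h) x)))"
proof -
  let ?D = "lie_derivative f"
  define P where "P m h = (\<Sum>j<K+2. h ^ j *\<^sub>R (real m ^ j / fact j) *\<^sub>R (?D ^^ j) (\<lambda>y. y) x)"
    for m and h :: real
  \<comment> \<open>Degree \<open>K - k\<close> suffices: the error has order
    \<open>K - k + 1\<close>, and \<open>F k\<close> enters with the factor
    \<open>h ^ Suc k\<close>, for a total of \<open>K + 2\<close>.\<close>
  define Q where "Q m k h = (\<Sum>j<Suc (K - k). h ^ j *\<^sub>R (real m ^ j / fact j) *\<^sub>R (?D ^^ j) (F k) x)"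
    for m k and h :: real
  have P: "vanishes_to_order (K + 2) (\<lambda>h. flow f (real m * h) x - P m h)" for m
    unfolding P_def using f smooth_ident by (rule flow_taylor_vanishes_to_order)
  have Q: "vanishes_to_order (K + 2)
      (\<lambda>h. h ^ Suc k *\<^sub>R (F k (flow f (real m * h) x) - Q m k h))" if "k \<le> K" for m k
  proof -
    have "K + 2 = Suc k + Suc (K - k)" using that by simp
    then show ?thesis
      unfolding Q_def using flow_taylor_vanishes_to_order[OF f F]
      by (simp only: vanishes_to_order_power_scaleR_iff)
  qed
  have sumP: "(\<Sum>m\<le>M. \<alpha> m *\<^sub>R P m h) = (\<Sum>k\<le>K. h ^ Suc k *\<^sub>R
      (\<Sum>m\<le>M. (\<alpha> m * (real m ^ (k + 1) / fact (k + 1))) *\<^sub>R (?D ^^ k) f x))" for h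
  proof -
    \<comment> \<open>The constant term \<open>x\<close> is split off, to be cancelled by
      \<open>\<alpha>\<close>; the remaining index is \<open>j = k + 1\<close>.\<close>
    have "P m h = x + (\<Sum>k\<le>K. h ^ Suc k *\<^sub>R (real m ^ (k + 1) / fact (k + 1)) *\<^sub>R (?D ^^ k) f x)" for m
      unfolding P_def add_2_eq_Suc'
      by (subst sum.lessThan_Suc_shift)
        (simp add: lessThan_Suc_atMost funpow_Suc_right lie_derivative_ident
          del: funpow.simps fact_Suc of_nat_Suc)
    then have "(\<Sum>m\<le>M. \<alpha> m *\<^sub>R P m h) = (\<Sum>m\<le>M. \<alpha> m) *\<^sub>R x + (\<Sum>m\<le>M. \<Sum>k\<le>K.
        h ^ Suc k *\<^sub>R (\<alpha> m * (real m ^ (k + 1) / fact (k + 1))) *\<^sub>R (?D ^^ k) f x)"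
      by (simp add: scaleR_add_right sum.distrib scaleR_sum_left scaleR_sum_right mult_ac)
    then show ?thesis
      by (subst (asm) sum.swap) (simp add: \<alpha> scaleR_sum_right)
  qed
  have sumQ: "(\<Sum>m\<le>M. \<beta> m *\<^sub>R (\<Sum>k\<le>K. h ^ Suc k *\<^sub>R Q m k h)) = (\<Sum>k\<le>K. h ^ Suc k *\<^sub>R
      (\<Sum>m\<le>M. \<beta> m *\<^sub>R (\<Sum>j\<le>k. (real m ^ j / fact j) *\<^sub>R (?D ^^ j) (F (k - j)) x)))" for h
  proof -
    have "(\<Sum>k\<le>K. h ^ Suc k *\<^sub>R Q m k h) =
      (\<Sum>k\<le>K. h ^ Suc k *\<^sub>R (\<Sum>j\<le>k. (real m ^ j / fact j) *\<^sub>R (?D ^^ j) (F (k - j)) x))" for m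
    proof -
      let ?c = "\<lambda>j k. h ^ Suc (j + k) *\<^sub>R (real m ^ j / fact j) *\<^sub>R (?D ^^ j) (F k) x"
      have "(\<Sum>k\<le>K. h ^ Suc k *\<^sub>R Q m k h) = (\<Sum>k\<le>K. \<Sum>j\<le>K - k. ?c j k)"
        unfolding Q_def lessThan_Suc_atMost
        by (simp add: scaleR_sum_right power_add mult_ac)
      \<comment> \<open>The triangle of index pairs is regrouped along its diagonals, so that terms
        with the same power of \<open>h\<close> are collected.\<close>
      also have "\<dots> = (\<Sum>(k, j)\<in>{(k, j). k + j \<le> K}. ?c j k)"
        by (subst sum.Sigma) (auto intro!: sum.cong)
      also have "\<dots> = (\<Sum>k\<le>K. \<Sum>i\<le>k. ?c (k - i) i)"
        by (rule sum.triangle_reindex_eq)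
      also have "\<dots> = (\<Sum>k\<le>K. \<Sum>j\<le>k. ?c j (k - j))"
      proof (rule sum.cong[OF refl])
        fix k
        show "(\<Sum>i\<le>k. ?c (k - i) i) = (\<Sum>j\<le>k. ?c j (k - j))"
          by (rule sum.reindex_bij_witness[of _ "\<lambda>j. k - j" "\<lambda>j. k - j"]) auto
      qed
      finally show ?thesis by (simp add: scaleR_sum_right)
    qed
    then have "(\<Sum>m\<le>M. \<beta> m *\<^sub>R (\<Sum>k\<le>K. h ^ Suc k *\<^sub>R Q m k h)) =
      (\<Sum>m\<le>M. \<Sum>k\<le>K. h ^ Suc k *\<^sub>R
        \<beta> m *\<^sub>R (\<Sum>j\<le>k. (real m ^ j / fact j) *\<^sub>R (?D ^^ j) (F (k - j)) x))"
      by (simp add: scaleR_sum_right mult_ac)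
    also have "\<dots> = (\<Sum>k\<le>K. \<Sum>m\<le>M. h ^ Suc k *\<^sub>R
        \<beta> m *\<^sub>R (\<Sum>j\<le>k. (real m ^ j / fact j) *\<^sub>R (?D ^^ j) (F (k - j)) x))"
      by (rule sum.swap)
    finally show ?thesis by (simp only: scaleR_sum_right)
  qed
  have eq: "(\<Sum>m\<le>M. \<alpha> m *\<^sub>R flow f (real m * h) x)
      - h *\<^sub>R (\<Sum>m\<le>M. \<beta> m *\<^sub>R truncated_field F K h (flow f (real m * h) x)) =
    (\<Sum>m\<le>M. \<alpha> m *\<^sub>R (flow f (real m * h) x - P m h)) -
    (\<Sum>m\<le>M. \<beta> m *\<^sub>R (\<Sum>k\<le>K. h ^ Suc k *\<^sub>R (F k (flow f (real m * h) x) - Q m k h)))" for h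
  proof -
    have "(\<Sum>m\<le>M. \<alpha> m *\<^sub>R P m h) = (\<Sum>m\<le>M. \<beta> m *\<^sub>R (\<Sum>k\<le>K. h ^ Suc k *\<^sub>R Q m k h))"
      unfolding sumP sumQ match ..
    moreover have "h *\<^sub>R (\<Sum>m\<le>M. \<beta> m *\<^sub>R truncated_field F K h (flow f (real m * h) x)) =
      (\<Sum>m\<le>M. \<beta> m *\<^sub>R (\<Sum>k\<le>K. h ^ Suc k *\<^sub>R F k (flow f (real m * h) x)))"
      by (simp add: truncated_field_def scaleR_sum_right mult_ac)
    ultimately show ?thesis
      by (simp add: scaleR_diff_right sum_subtractf)
  qed
  show ?thesis
    unfolding eq
    by (intro vanishes_to_order_diff vanishes_to_order_sum vanishes_to_order_scaleR P Q) simp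
qed

text \<open>Continuity of the fields lets the limit at step size 0 pass through the flow and
  identify the leading difference at \<open>x\<close>.\<close>

lemma multistep_field_unique:
  fixes f :: "'a::euclidean_space \<Rightarrow> 'a"
  assumes f: "smooth f" and \<beta>: "(\<Sum>m\<le>M. \<beta> m) \<noteq> 0"
    and F: "\<And>k. k \<le> K \<Longrightarrow> continuous_on UNIV (F k)"
    and G: "\<And>k. k \<le> K \<Longrightarrow> continuous_on UNIV (G k)"
    and sat: "satisfies_multistep_to_order M \<alpha> \<beta> f K F" "satisfies_multistep_to_order M \<alpha> \<beta> f K G"
    and "k \<le> K"
  shows "G k = F k"
  using \<open>k \<le> K\<close>
proof (induction k rule: less_induct)
  case (less k)
  show ?case
  proof
    fix x
    define d where "d i y = G i y - F i y" for i y
    \<comment> \<open>\<open>E\<close> is the difference of the two residuals divided by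
      \<open>h ^ Suc k\<close>; the terms with \<open>i < k\<close> are absent by the induction
      hypothesis.\<close>
    define E where "E h = (\<Sum>m\<le>M. \<beta> m *\<^sub>R (\<Sum>i=k..K. h ^ (i - k) *\<^sub>R d i (flow f (real m * h) x)))"
      for h :: real
    let ?y = "\<lambda>m h. flow f (real m * h) x"
    have "(\<Sum>i\<le>K. h ^ i *\<^sub>R d i y) = h ^ k *\<^sub>R (\<Sum>i=k..K. h ^ (i - k) *\<^sub>R d i y)" for h y
    proof -
      have "(\<Sum>i\<le>K. h ^ i *\<^sub>R d i y) = (\<Sum>i=k..K. h ^ i *\<^sub>R d i y)"
        using less by (intro sum.mono_neutral_right) (auto simp: d_def)
      also have "\<dots> = (\<Sum>i=k..K. h ^ k *\<^sub>R h ^ (i - k) *\<^sub>R d i y)"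
        by (intro sum.cong) (auto simp flip: power_add)
      finally show ?thesis by (simp only: scaleR_sum_right)
    qed
    moreover have "truncated_field G K h y - truncated_field F K h y = (\<Sum>i\<le>K. h ^ i *\<^sub>R d i y)" for h y
      by (simp add: truncated_field_def d_def scaleR_diff_right sum_subtractf)
    ultimately have diff: "truncated_field G K h y - truncated_field F K h y =
        h ^ k *\<^sub>R (\<Sum>i=k..K. h ^ (i - k) *\<^sub>R d i y)" for h y
      by simp
    have "((\<Sum>m\<le>M. \<alpha> m *\<^sub>R ?y m h) - h *\<^sub>R (\<Sum>m\<le>M. \<beta> m *\<^sub>R truncated_field F K h (?y m h)))
      - ((\<Sum>m\<le>M. \<alpha> m *\<^sub>R ?y m h) - h *\<^sub>R (\<Sum>m\<le>M. \<beta> m *\<^sub>R truncated_field G K h (?y m h)))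
      = h ^ Suc k *\<^sub>R E h" for h
    proof -
      have "h *\<^sub>R (\<Sum>m\<le>M. \<beta> m *\<^sub>R truncated_field G K h (?y m h))
        - h *\<^sub>R (\<Sum>m\<le>M. \<beta> m *\<^sub>R truncated_field F K h (?y m h))
        = h *\<^sub>R (\<Sum>m\<le>M. \<beta> m *\<^sub>R (truncated_field G K h (?y m h) - truncated_field F K h (?y m h)))"
        by (simp add: scaleR_diff_right sum_subtractf)
      also have "\<dots> = h ^ Suc k *\<^sub>R E h"
        unfolding diff E_def by (simp add: scaleR_sum_right mult_ac)
      finally show ?thesis by simp
    qed
    moreover have "vanishes_to_order (K + 2) (\<lambda>h.
      ((\<Sum>m\<le>M. \<alpha> m *\<^sub>R ?y m h) - h *\<^sub>R (\<Sum>m\<le>M. \<beta> m *\<^sub>R truncated_field F K h (?y m h)))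
      - ((\<Sum>m\<le>M. \<alpha> m *\<^sub>R ?y m h) - h *\<^sub>R (\<Sum>m\<le>M. \<beta> m *\<^sub>R truncated_field G K h (?y m h))))"
      by (rule vanishes_to_order_diff)
        (use sat in \<open>simp_all add: satisfies_multistep_to_order_def vanishes_to_order_def\<close>)
    ultimately have "vanishes_to_order (K + 2) (\<lambda>h. h ^ Suc k *\<^sub>R E h)" by simp
    \<comment> \<open>After cancelling \<open>h ^ Suc k\<close> at least one power of
      \<open>h\<close> is left, which forces \<open>E\<close> to tend to 0.\<close>
    moreover have "K + 2 = Suc k + Suc (K - k)" using less.prems by simp
    ultimately have "vanishes_to_order (Suc (K - k)) E"
      by (simp only: vanishes_to_order_power_scaleR_iff)
    then have E0: "(E \<longlongrightarrow> 0) (at 0)" by (rule vanishes_to_order_Suc_tendsto)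
    have "((\<lambda>h. d i (?y m h)) \<longlongrightarrow> d i x) (at 0)" if "i \<in> {k..K}" for i m
    proof -
      have "continuous_on UNIV (d i)"
        unfolding d_def using F G that by (intro continuous_on_diff) auto
      then have "isCont (d i) x" by (simp add: continuous_on_eq_continuous_at)
      then show ?thesis using flow_tendsto[OF f] by (rule isCont_tendsto_compose)
    qed
    then have "(E \<longlongrightarrow> (\<Sum>m\<le>M. \<beta> m *\<^sub>R (\<Sum>i=k..K. 0 ^ (i - k) *\<^sub>R d i x))) (at 0)"
      unfolding E_def by (intro tendsto_intros) auto
    \<comment> \<open>Since \<open>0 ^ 0 = 1\<close>, exactly the term \<open>i = k\<close>
      survives.\<close>
    also have "(\<Sum>i=k..K. 0 ^ (i - k) *\<^sub>R d i x) = (\<Sum>i\<in>{k}. 0 ^ (i - k) *\<^sub>R d i x)"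
      using less.prems by (intro sum.mono_neutral_right) auto
    finally have "(E \<longlongrightarrow> (\<Sum>m\<le>M. \<beta> m) *\<^sub>R d k x) (at 0)"
      by (simp add: scaleR_sum_left)
    with E0 have "(\<Sum>m\<le>M. \<beta> m) *\<^sub>R d k x = 0"
      using tendsto_unique[of "at (0::real)" E] by (metis at_neq_bot)
    then show "G k x = F k x" using \<beta> by (simp add: d_def)
  qed
qed

theorem theorem5:
  fixes f :: "real ^ 'n \<Rightarrow> real ^ 'n"
    and \<alpha> \<beta> :: "nat \<Rightarrow> real" and M :: nat
  assumes "smooth f"
    and "linear_multistep_method M \<alpha> \<beta>"
    and "weakly_stable M \<alpha>"
    and "consistent M \<alpha> \<beta>"
  shows "\<exists>F :: nat \<Rightarrow> real ^ 'n \<Rightarrow> real ^ 'n.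
    (\<forall>k. smooth (F k)) \<and>
    (\<forall>K. satisfies_multistep_to_order M \<alpha> \<beta> f K F \<and>
         (\<forall>G. (\<forall>k\<le>K. continuous_on UNIV (G k)) \<and>
              satisfies_multistep_to_order M \<alpha> \<beta> f K G \<longrightarrow> (\<forall>k\<le>K. G k = F k))) \<and>
    (\<forall>k y. F k y =
       (1 / (\<Sum>m\<le>M. \<beta> m)) *\<^sub>R
         (\<Sum>m\<le>M. (\<alpha> m * (real m ^ (k + 1) / fact (k + 1))) *\<^sub>R (lie_derivative f ^^ k) f y)
     - (1 / (\<Sum>m\<le>M. \<beta> m)) *\<^sub>R
         (\<Sum>m\<le>M. \<beta> m *\<^sub>R
           (\<Sum>j=1..k. (real m ^ j / fact j) *\<^sub>R (lie_derivative f ^^ j) (F (k - j)) y)))"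
proof -
  \<comment> \<open>Consistency equates the sum of the \<open>\<beta> m\<close> with the first
    moment of \<open>\<alpha>\<close>, which weak stability makes nonzero.\<close>
  have \<alpha>: "(\<Sum>m\<le>M. \<alpha> m) = 0" and \<beta>: "(\<Sum>m\<le>M. \<beta> m) \<noteq> 0"
    using assms(3,4) by (auto simp: weakly_stable_def consistent_def)
  \<comment> \<open>The recursion does not mention \<open>K\<close>, so one sequence of fields
    serves every truncation order.\<close>
  let ?F = "modified_field M \<alpha> \<beta> f"
  have sat: "satisfies_multistep_to_order M \<alpha> \<beta> f K ?F" for K
    unfolding satisfies_multistep_to_order_def vanishes_to_order_def[symmetric]
    by (intro allI multistep_residual_vanishes assms(1) smooth_modified_field \<alpha>
        modified_field_coefficient_match \<beta>)
  show ?thesis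
  proof (intro exI[of _ ?F] conjI allI impI)
    show "smooth (?F k)" for k by (rule smooth_modified_field[OF assms(1)])
    show "satisfies_multistep_to_order M \<alpha> \<beta> f K ?F" for K by (rule sat)
    show "G k = ?F k" if "(\<forall>k\<le>K. continuous_on UNIV (G k)) \<and>
        satisfies_multistep_to_order M \<alpha> \<beta> f K G" and "k \<le> K" for K G k
      using that smooth_continuous_on[OF smooth_modified_field[OF assms(1)]]
      by (intro multistep_field_unique[OF assms(1) \<beta> _ _ sat]) auto
  qed (rule fun_cong[OF modified_field.simps])
qed

end
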